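(* Let $p$ be a positive integer. For $n\ge 0$, let $\mathcal{B}^{(p)}_n$ denote the set of $p$-Fibonacci polyominoes with $n$ columns (with $\mathcal{B}^{(p)}_0$ consisting only of the empty polyomino), and define \[F_p(x;y,z)=\sum_{n\ge 0}x^n\sum_{P\in\mathcal{B}^{(p)}_n} y^{\mathrm{area}(P)}z^{\mathrm{sper}(P)}.\] Then \[F_p(x;y,z)=1+\frac{\sum_{i=1}^{p}x^{p-i+1}y^{\frac12(p+i)(p-i+1)}z^{2p-i+1}}{1-xy^pz-\sum_{i=1}^{p-1}x^{p-i+1}y^{\frac12(p+i)(p-i+1)}z^{2p-2i+1}}.\]
   Context: A $p$-Fibonacci word of length $n\ge 1$ is a word $u=u_1u_2\cdots u_n$ over $\{1,\dots,p\}$ with $u_1=p$ and, for $1\le i\le n-1$: if $u_i=1$ then $u_{i+1}=p$; if $2\le u_i\le p$ then $u_{i+1}\in\{u_i-1,\,p\}$. The empty word is the unique $p$-Fibonacci word of length $0$. Each $p$-Fibonacci word $u=u_1\cdots u_n$ determines a polyomino (bargraph) with $n$ columns: a sequence of $n$ adjacent columns of unit square cells, all resting on a common horizontal base line, where the $i$-th column consists of $u_i$ cells stacked vertically; these are the $p$-Fibonacci polyominoes. For such a polyomino $P$, $\mathrm{area}(P)$ is the number of cells of $P$ and $\mathrm{sper}(P)$ is half the length of the perimeter (boundary) of $P$. The empty polyomino has area $0$ and semi-perimeter $0$. *)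

theory Defs
  imports "HOL-Computational_Algebra.Formal_Power_Series"
begin

(* Words are lists, indexed from 0. *)
definition fibonacci_word :: "nat \<Rightarrow> nat list \<Rightarrow> bool" where
  "fibonacci_word p u \<longleftrightarrow>
     set u \<subseteq> {1..p} \<and>
     (u \<noteq> [] \<longrightarrow> u ! 0 = p) \<and>
     (\<forall>i. Suc i < length u \<longrightarrow>
        (u ! i = 1 \<longrightarrow> u ! Suc i = p) \<and>
        (2 \<le> u ! i \<and> u ! i \<le> p \<longrightarrow> u ! Suc i \<in> {u ! i - 1, p}))"

(* The pair (a, b) stands for the unit square [a, a + 1] x [b, b + 1] of the plane. *)
type_synonym cell = "int \<times> int"

(* The base line is the axis b = 0, and the columns occupy abscissae 0, ..., length u - 1. *)
definition bargraph :: "nat list \<Rightarrow> cell set" where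
  "bargraph u = {(int i, int j) | i j. i < length u \<and> j < u ! i}"

definition fibonacci_polyominoes :: "nat \<Rightarrow> nat \<Rightarrow> cell set set" where
  "fibonacci_polyominoes p n = bargraph ` {u. fibonacci_word p u \<and> length u = n}"

definition area :: "cell set \<Rightarrow> nat" where
  "area P = card P"

definition neighbours :: "cell \<Rightarrow> cell set" where
  "neighbours c = (case c of (a, b) \<Rightarrow> {(a - 1, b), (a + 1, b), (a, b - 1), (a, b + 1)})"

(* A unit edge lies on the boundary of P iff exactly one of the two cells it separates belongs
   to P, so boundary edges correspond to pairs of an inner cell and an adjacent outer cell. *)
definition perimeter :: "cell set \<Rightarrow> nat" where
  "perimeter P = card {(c, d). c \<in> P \<and> d \<in> neighbours c \<and> d \<notin> P}"

(* The division is exact for finite P, see lemma even_perimeter. *)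
definition semiperimeter :: "cell set \<Rightarrow> nat" where
  "semiperimeter P = perimeter P div 2"

lemma even_perimeter:
  assumes "finite P"
  shows "even (perimeter P)"
proof -
  define E where "E = (\<lambda>x y. {(a, b) \<in> P. (a + x, b + y) \<notin> P})"
  define S where "S = (\<lambda>x y. (\<lambda>(a, b). ((a, b), (a + x, b + y))) ` E x y)"
  have fin: "finite (S x y)" for x y :: int
    unfolding S_def E_def by (intro finite_imageI finite_subset[OF _ assms]) auto
  have cardS: "card (S x y) = card (E x y)" for x y :: int
    unfolding S_def by (intro card_image inj_onI) auto
  have sym: "card (E x y) = card (E (- x) (- y))" for x y :: int
  proof -
    have "bij_betw (\<lambda>(a, b). (a + x, b + y)) {(a, b) \<in> P. (a + x, b + y) \<in> P}
            {(a, b) \<in> P. (a - x, b - y) \<in> P}"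
      by (rule bij_betw_byWitness[where f' = "\<lambda>(a, b). (a - x, b - y)"]) auto
    then have "card {(a, b) \<in> P. (a + x, b + y) \<in> P} = card {(a, b) \<in> P. (a - x, b - y) \<in> P}"
      by (rule bij_betw_same_card)
    moreover have "card (E x y) = card P - card {(a, b) \<in> P. (a + x, b + y) \<in> P}" for x y
    proof -
      have "E x y = P - {(a, b) \<in> P. (a + x, b + y) \<in> P}"
        by (auto simp: E_def)
      moreover have "finite {(a, b) \<in> P. (a + x, b + y) \<in> P}"
        by (rule finite_subset[OF _ assms]) auto
      ultimately show ?thesis
        by (auto intro!: card_Diff_subset)
    qed
    note this[of x y] this[of "- x" "- y"]
    ultimately show ?thesis by simp
  qed
  have "{(c, d). c \<in> P \<and> d \<in> neighbours c \<and> d \<notin> P} =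
      (S 1 0 \<union> S (- 1) 0) \<union> (S 0 1 \<union> S 0 (- 1))"
    by (auto simp: S_def E_def neighbours_def image_iff)
  then have "perimeter P = card ((S 1 0 \<union> S (- 1) 0) \<union> (S 0 1 \<union> S 0 (- 1)))"
    by (simp add: perimeter_def)
  also have "\<dots> = card (S 1 0 \<union> S (- 1) 0) + card (S 0 1 \<union> S 0 (- 1))"
    by (rule card_Un_disjoint) (simp add: fin, simp add: fin, auto simp: S_def)
  also have "card (S 1 0 \<union> S (- 1) 0) = card (S 1 0) + card (S (- 1) 0)"
    by (rule card_Un_disjoint) (simp add: fin, simp add: fin, auto simp: S_def)
  also have "card (S 0 1 \<union> S 0 (- 1)) = card (S 0 1) + card (S 0 (- 1))"
    by (rule card_Un_disjoint) (simp add: fin, simp add: fin, auto simp: S_def)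
  finally show ?thesis
    using sym[of 1 0] sym[of 0 1] by (simp add: cardS)
qed

lemma finite_bargraph: "finite (bargraph u)"
proof -
  have "bargraph u = (\<Union>i<length u. (\<lambda>j. (int i, int j)) ` {..<u ! i})"
    by (auto simp: bargraph_def)
  then show ?thesis by simp
qed

lemma finite_fibonacci_polyominoes: "finite (fibonacci_polyominoes p n)"
proof -
  have "finite {u. set u \<subseteq> {1..p} \<and> length u = n}"
    by (rule finite_lists_length_eq) simp
  then show ?thesis
    unfolding fibonacci_polyominoes_def fibonacci_word_def
    by (intro finite_imageI) (rule finite_subset[rotated], auto)
qed

(* Q[[z]][[y]][[x]]: the outermost variable is x and the innermost one is z. *)
type_synonym xyz_series = "rat fps fps fps"

definition var_x :: xyz_series where "var_x = fps_X"
definition var_y :: xyz_series where "var_y = fps_const fps_X"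
definition var_z :: xyz_series where "var_z = fps_const (fps_const fps_X)"

(* In the coefficient ring Q[[z]][[y]], y is fps_X and z is fps_const fps_X. *)
definition fib_gf :: "nat \<Rightarrow> xyz_series" where
  "fib_gf p = Abs_fps (\<lambda>n. \<Sum>P\<in>fibonacci_polyominoes p n.
                        fps_X ^ area P * fps_const fps_X ^ semiperimeter P)"

(* The base ring of xyz_series is not a field, but division by a series whose constant
   coefficient is 1 is genuine division. *)
lemma xyz_divide_mult_cancel:
  fixes f g :: xyz_series
  assumes "fps_nth g 0 = 1"
  shows "f / g * g = f"
proof -
  have "inverse (1 :: rat fps fps) = 1"
    by (rule fps_inverse_one') simp
  then have "inverse g * g = 1"
    using fps_right_inverse[of g 1] assms by (simp add: fps_inverse_def mult.commute)
  moreover have "f / g = f * inverse g"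
    using assms by (intro fps_divide_unit') (simp add: subdegree_eq_0)
  ultimately show ?thesis
    by (simp add: mult.assoc)
qed

end

theory Submission
  imports Defs
begin

text \<open>
  Let \<open>T a\<close> be the generating function of all words that may follow a letter \<open>a\<close>. Reading off
  the next letter gives \<open>T a = 1 + x y\<^sup>p z\<^bsup>1+p-a\<^esup> T p + x y\<^bsup>a-1\<^esup> z T (a - 1)\<close>, the last term being
  absent for \<open>a \<le> 1\<close>: the semi-perimeter of a bargraph is its number of columns plus the sum of
  its rises. Unfolding down to \<open>a = 1\<close> expresses \<open>T p\<close> linearly through itself. The whole series
  is \<open>T 0\<close>, where \<open>0\<close> is a fictitious column of height \<open>0\<close> in front of the word.
\<close>

section \<open>Area and semi-perimeter of a bargraph\<close>

text \<open>Translation by \<open>(x, y)\<close> matches the cells whose translate stays in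
  \<open>P\<close> with those whose back-translate does; finiteness lets both counts be subtracted
  from \<open>card P\<close>.\<close>

lemma card_shift_outside:
  fixes P :: "cell set"
  assumes "finite P"
  shows "card {(a, b) \<in> P. (a + x, b + y) \<notin> P} = card {(a, b) \<in> P. (a - x, b - y) \<notin> P}"
proof -
  have eq: "card {(a, b) \<in> P. (a + x, b + y) \<notin> P} = card P - card {(a, b) \<in> P. (a + x, b + y) \<in> P}"
    for x y
  proof -
    have "{(a, b) \<in> P. (a + x, b + y) \<notin> P} = P - {(a, b) \<in> P. (a + x, b + y) \<in> P}" by auto
    moreover have "finite {(a, b) \<in> P. (a + x, b + y) \<in> P}"
      by (rule finite_subset[OF _ assms]) auto
    ultimately show ?thesis by (auto intro!: card_Diff_subset)
  qed
  have "bij_betw (\<lambda>(a, b). (a + x, b + y)) {(a, b) \<in> P. (a + x, b + y) \<in> P}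
          {(a, b) \<in> P. (a - x, b - y) \<in> P}"
    by (rule bij_betw_byWitness[where f' = "\<lambda>(a, b). (a - x, b - y)"]) auto
  then have "card {(a, b) \<in> P. (a + x, b + y) \<in> P} = card {(a, b) \<in> P. (a - x, b - y) \<in> P}"
    by (rule bij_betw_same_card)
  then show ?thesis using eq[of x y] eq[of "- x" "- y"] by simp
qed

text \<open>Boundary edges fall into four directions. Opposite directions are equinumerous, so half
  the perimeter counts just the upper and the left edges.\<close>

lemma semiperimeter_eq:
  assumes "finite P"
  shows "semiperimeter P = card {(a, b) \<in> P. (a, b + 1) \<notin> P} + card {(a, b) \<in> P. (a - 1, b) \<notin> P}"
proof -
  define E where "E = (\<lambda>x y. {(a, b) \<in> P. (a + x, b + y) \<notin> P})"
  define S where "S = (\<lambda>x y. (\<lambda>(a, b). ((a, b), (a + x, b + y))) ` E x y)"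
  have fin: "finite (S x y)" for x y :: int
    unfolding S_def E_def by (intro finite_imageI finite_subset[OF _ assms]) auto
  have cardS: "card (S x y) = card (E x y)" for x y :: int
    unfolding S_def by (intro card_image inj_onI) auto
  have "{(c, d). c \<in> P \<and> d \<in> neighbours c \<and> d \<notin> P} =
      (S 1 0 \<union> S (- 1) 0) \<union> (S 0 1 \<union> S 0 (- 1))"
    by (auto simp: S_def E_def neighbours_def image_iff)
  then have "perimeter P = card ((S 1 0 \<union> S (- 1) 0) \<union> (S 0 1 \<union> S 0 (- 1)))"
    by (simp add: perimeter_def)
  also have "\<dots> = card (S 1 0 \<union> S (- 1) 0) + card (S 0 1 \<union> S 0 (- 1))"
    by (rule card_Un_disjoint) (simp add: fin, simp add: fin, auto simp: S_def)
  also have "card (S 1 0 \<union> S (- 1) 0) = card (S 1 0) + card (S (- 1) 0)"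
    by (rule card_Un_disjoint) (simp add: fin, simp add: fin, auto simp: S_def)
  also have "card (S 0 1 \<union> S 0 (- 1)) = card (S 0 1) + card (S 0 (- 1))"
    by (rule card_Un_disjoint) (simp add: fin, simp add: fin, auto simp: S_def)
  finally have "perimeter P = card (E 1 0) + card (E (- 1) 0) + (card (E 0 1) + card (E 0 (- 1)))"
    by (simp add: cardS)
  then show ?thesis
    using card_shift_outside[OF assms, of 1 0] card_shift_outside[OF assms, of 0 1]
    by (simp add: semiperimeter_def E_def)
qed

text \<open>Used three times: to count all cells, the upper edges and the left edges, each column by
  column.\<close>

lemma card_columns:
  fixes f :: "nat \<Rightarrow> nat set"
  assumes "\<And>i. i < n \<Longrightarrow> finite (f i)"
  shows "card {(int i, int j) | i j. i < n \<and> j \<in> f i} = (\<Sum>i<n. card (f i))"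
proof -
  have "{(int i, int j) | i j. i < n \<and> j \<in> f i} = map_prod int int ` (SIGMA i:{..<n}. f i)"
    by auto
  then have "card {(int i, int j) | i j. i < n \<and> j \<in> f i} = card (SIGMA i:{..<n}. f i)"
    by (simp add: card_image map_prod_inj_on inj_on_def)
  then show ?thesis using assms by simp
qed

lemma mem_bargraph: "(a, b) \<in> bargraph u \<longleftrightarrow> 0 \<le> a \<and> 0 \<le> b \<and> nat a < length u \<and> nat b < u ! nat a"
  by (force simp: bargraph_def)

lemma area_bargraph: "area (bargraph u) = sum_list u"
  using card_columns[of "length u" "\<lambda>i. {..<u ! i}"]
  by (simp add: area_def bargraph_def sum_list_sum_nth atLeast0LessThan)

text \<open>Truncated subtraction discards the descents.\<close>

primrec rises :: "nat \<Rightarrow> nat list \<Rightarrow> nat" where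
  "rises a [] = 0"
| "rises a (b # v) = (b - a) + rises b v"

lemma rises_conv_sum: "rises a v = (\<Sum>i<length v. v ! i - (a # v) ! i)"
  by (induction v arbitrary: a) (simp_all add: sum.lessThan_Suc_shift del: sum.lessThan_Suc)

text \<open>Every nonempty column has exactly one upper edge, and its left edges lie at the cells
  above the height of the preceding column. A column of height 0 would have no upper edge.\<close>

lemma semiperimeter_bargraph:
  assumes "0 \<notin> set u"
  shows "semiperimeter (bargraph u) = length u + rises 0 u"
proof -
  have pos: "0 < u ! i" if "i < length u" for i
    using assms that by (metis nth_mem gr0I)
  have "{(a, b) \<in> bargraph u. (a, b + 1) \<notin> bargraph u} =
      {(int i, int j) | i j. i < length u \<and> j \<in> {u ! i - 1}}" (is "?L = ?R")
  proof (intro set_eqI iffI)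
    fix c assume "c \<in> ?L"
    then obtain i j where "c = (int i, int j)" "i < length u" "j < u ! i"
      "(int i, int j + 1) \<notin> bargraph u"
      by (auto simp: bargraph_def)
    then show "c \<in> ?R" by (auto simp: mem_bargraph nat_add_distrib)
  next
    fix c assume "c \<in> ?R"
    then show "c \<in> ?L" using pos by (auto simp: mem_bargraph nat_add_distrib)
  qed
  then have top: "card {(a, b) \<in> bargraph u. (a, b + 1) \<notin> bargraph u} = length u"
    using card_columns[of "length u" "\<lambda>i. {u ! i - 1}"] by simp
  have "{(a, b) \<in> bargraph u. (a - 1, b) \<notin> bargraph u} =
      {(int i, int j) | i j. i < length u \<and> j \<in> {(0 # u) ! i..<u ! i}}" (is "?L = ?R")
  proof (intro set_eqI iffI)
    fix c assume "c \<in> ?L"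
    then obtain i j where c: "c = (int i, int j)" "i < length u" "j < u ! i"
      "(int i - 1, int j) \<notin> bargraph u"
      by (auto simp: bargraph_def)
    \<comment> \<open>For \<open>i = 0\<close> the left neighbour has abscissa -1 and is always
      outside, in agreement with the height 0 put in front.\<close>
    then have "(0 # u) ! i \<le> j" by (cases i) (auto simp: mem_bargraph)
    with c show "c \<in> ?R" by auto
  next
    fix c assume "c \<in> ?R"
    then obtain i j where "c = (int i, int j)" "i < length u" "j < u ! i" "(0 # u) ! i \<le> j"
      by auto
    then show "c \<in> ?L" by (cases i) (auto simp: mem_bargraph nat_add_distrib)
  qed
  then have "card {(a, b) \<in> bargraph u. (a - 1, b) \<notin> bargraph u} = rises 0 u"
    using card_columns[of "length u" "\<lambda>i. {(0 # u) ! i..<u ! i}"] by (simp add: rises_conv_sum)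
  with top show ?thesis by (simp add: semiperimeter_eq[OF finite_bargraph])
qed

text \<open>Columns of height 0 at the right end leave no trace in the cell set, hence the
  assumption on lengths.\<close>

lemma bargraph_eqD:
  assumes "bargraph u = bargraph v" "length u = length v"
  shows "u = v"
proof (rule nth_equalityI[OF assms(2)])
  fix i assume i: "i < length u"
  have "j < u ! i \<longleftrightarrow> j < v ! i" for j
    using i assms mem_bargraph[of "int i" "int j" u] mem_bargraph[of "int i" "int j" v] by simp
  then show "u ! i = v ! i" by (meson linorder_less_linear less_irrefl)
qed

section \<open>Continuations of a letter\<close>

text \<open>The form \<open>a = Suc b\<close> allows only \<open>p\<close> after the fictitious
  letter 0, which encodes the condition on the first letter; \<open>1 \<le> b\<close> forbids
  descending from 1.\<close>

definition fib_step :: "nat \<Rightarrow> nat \<Rightarrow> nat \<Rightarrow> bool" where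
  "fib_step p a b \<longleftrightarrow> b = p \<or> (1 \<le> b \<and> a = Suc b)"

definition continuations :: "nat \<Rightarrow> nat \<Rightarrow> nat \<Rightarrow> nat list set" where
  "continuations p a n = {v. successively (fib_step p) (a # v) \<and> length v = n}"

text \<open>The bound \<open>a \<le> p\<close> is an invariant: a step goes to \<open>p\<close> or
  down by one, never below 1.\<close>

lemma set_continuation:
  assumes "successively (fib_step p) (a # v)" "a \<le> p" "p \<ge> 1"
  shows "set v \<subseteq> {1..p}"
  using assms
proof (induction v arbitrary: a)
  case (Cons b v)
  then have "b \<in> {1..p}" by (auto simp: fib_step_def)
  moreover from this have "set v \<subseteq> {1..p}" using Cons by (intro Cons.IH[of b]) simp_all
  ultimately show ?case by simp
qed simp

lemma fibonacci_word_iff: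
  assumes "p \<ge> 1"
  shows "fibonacci_word p u \<longleftrightarrow> successively (fib_step p) (0 # u)"
proof
  assume u: "fibonacci_word p u"
  have "fib_step p ((0 # u) ! i) (u ! i)" if "i < length u" for i
  proof (cases i)
    case 0
    with u that show ?thesis by (auto simp: fibonacci_word_def fib_step_def)
  next
    case (Suc k)
    have "set u \<subseteq> {1..p}" using u by (simp add: fibonacci_word_def)
    moreover have "u ! k \<in> set u" "u ! Suc k \<in> set u" using that Suc by simp_all
    ultimately have "u ! k \<in> {1..p}" "u ! Suc k \<in> {1..p}" by blast+
    moreover have "u ! k = 1 \<longrightarrow> u ! Suc k = p"
      "2 \<le> u ! k \<and> u ! k \<le> p \<longrightarrow> u ! Suc k \<in> {u ! k - 1, p}"
      using u that Suc unfolding fibonacci_word_def by blast+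
    ultimately show ?thesis
      using Suc by (cases "u ! k = 1") (auto simp: fib_step_def)
  qed
  then show "successively (fib_step p) (0 # u)"
    by (auto simp: successively_conv_nth)
next
  assume u: "successively (fib_step p) (0 # u)"
  then have step: "fib_step p ((0 # u) ! i) (u ! i)" if "i < length u" for i
    using that by (auto simp: successively_conv_nth)
  have "u \<noteq> [] \<longrightarrow> u ! 0 = p" using step[of 0] by (auto simp: fib_step_def)
  moreover have "u ! Suc i = p \<or> 1 \<le> u ! Suc i \<and> u ! i = Suc (u ! Suc i)"
    if "Suc i < length u" for i
    using step[OF that] by (simp add: fib_step_def)
  ultimately show "fibonacci_word p u"
    using set_continuation[OF u _ assms] by (fastforce simp: fibonacci_word_def)
qed

lemma finite_continuations:
  assumes "a \<le> p" "p \<ge> 1"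
  shows "finite (continuations p a n)"
  by (rule finite_subset[OF _ finite_lists_length_eq[of "{1..p}" n]])
     (use set_continuation[OF _ assms] in \<open>auto simp: continuations_def\<close>)

lemma continuations_0: "continuations p a 0 = {[]}"
  by (auto simp: continuations_def)

lemma continuations_Suc:
  "continuations p a (Suc n) = (#) p ` continuations p p n \<union>
     (if a \<ge> 2 then (#) (a - 1) ` continuations p (a - 1) n else {})"
  by (auto simp: continuations_def fib_step_def length_Suc_conv image_iff)

text \<open>The contribution of \<open>v\<close> to area and semi-perimeter when it stands to the
  right of a column of height \<open>a\<close>.\<close>

definition weight :: "nat \<Rightarrow> nat list \<Rightarrow> rat fps fps" where
  "weight a v = fps_X ^ sum_list v * fps_const fps_X ^ (length v + rises a v)"

definition continuation_gf :: "nat \<Rightarrow> nat \<Rightarrow> xyz_series" where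
  "continuation_gf p a = Abs_fps (\<lambda>n. \<Sum>v\<in>continuations p a n. weight a v)"

lemma weight_Cons: "weight a (b # v) = fps_X ^ b * fps_const fps_X ^ (1 + (b - a)) * weight b v"
  by (simp add: weight_def power_add mult_ac)

lemma sum_weight_Cons:
  "(\<Sum>v\<in>(#) b ` A. weight a v) = fps_X ^ b * fps_const fps_X ^ (1 + (b - a)) * (\<Sum>v\<in>A. weight b v)"
  by (subst sum.reindex) (simp_all add: weight_Cons sum_distrib_left del: power_Suc)

lemma fib_gf_conv_continuation_gf:
  assumes "p \<ge> 1"
  shows "fib_gf p = continuation_gf p 0"
proof (rule fps_ext)
  fix n
  \<comment> \<open>Words of equal length are determined by their bargraphs, so the sum over
    polyominoes becomes a sum over words.\<close>
  have inj: "inj_on bargraph (continuations p 0 n)"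
    by (rule inj_onI) (auto simp: continuations_def dest: bargraph_eqD)
  have "fibonacci_polyominoes p n = bargraph ` continuations p 0 n"
    by (simp add: fibonacci_polyominoes_def continuations_def fibonacci_word_iff[OF assms])
  then have "fps_nth (fib_gf p) n = (\<Sum>u\<in>continuations p 0 n.
      fps_X ^ area (bargraph u) * fps_const fps_X ^ semiperimeter (bargraph u))"
    by (simp add: fib_gf_def sum.reindex[OF inj])
  also have "\<dots> = (\<Sum>u\<in>continuations p 0 n. weight 0 u)"
  proof (rule sum.cong[OF refl])
    fix u assume "u \<in> continuations p 0 n"
    then have "0 \<notin> set u"
      using set_continuation[of p 0 u] assms by (auto simp: continuations_def)
    then show "fps_X ^ area (bargraph u) * fps_const fps_X ^ semiperimeter (bargraph u) = weight 0 u"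
      by (simp add: area_bargraph semiperimeter_bargraph weight_def)
  qed
  finally show "fps_nth (fib_gf p) n = fps_nth (continuation_gf p 0) n"
    by (simp add: continuation_gf_def)
qed

section \<open>The functional equation\<close>

text \<open>Over the coefficient ring, \<open>var_y\<close> and \<open>var_z\<close> are constants,
  while \<open>var_x\<close> shifts coefficients by one.\<close>

lemma nth_monomial_mult:
  "fps_nth (var_x * var_y ^ k * var_z ^ l * G) n =
     (if n = 0 then 0 else fps_X ^ k * fps_const fps_X ^ l * fps_nth G (n - 1))"
proof -
  have "var_x * var_y ^ k * var_z ^ l * G = fps_X * (fps_const (fps_X ^ k * fps_const fps_X ^ l) * G)"
    by (simp only: var_x_def var_y_def var_z_def fps_const_power fps_const_mult[symmetric] mult.assoc)
  then show ?thesis by (simp only: fps_X_mult_nth fps_mult_left_const_nth)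
qed

text \<open>Splits by the next letter: each new column costs one factor \<open>var_z\<close>, the
  step to \<open>p\<close> adds \<open>p - a\<close> rises, and the descent adds none.\<close>

lemma continuation_gf_rec:
  assumes "a \<le> p" "p \<ge> 1"
  shows "continuation_gf p a = 1 + var_x * var_y ^ p * var_z ^ (1 + (p - a)) * continuation_gf p p
    + (if a \<ge> 2 then var_x * var_y ^ (a - 1) * var_z * continuation_gf p (a - 1) else 0)"
    (is "_ = ?R")
proof (rule fps_ext)
  fix n
  show "fps_nth (continuation_gf p a) n = fps_nth ?R n"
  proof (cases n)
    case 0
    then show ?thesis
      by (simp add: nth_monomial_mult nth_monomial_mult[where l = 1, unfolded power_one_right]
               continuation_gf_def continuations_0 weight_def
               del: power_Suc power_one_right fps_mult_nth_0)
  next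
    case (Suc m)
    have "(\<Sum>v\<in>continuations p a n. weight a v) = (\<Sum>v\<in>(#) p ` continuations p p m. weight a v)
      + (\<Sum>v\<in>(if a \<ge> 2 then (#) (a - 1) ` continuations p (a - 1) m else {}). weight a v)"
      \<comment> \<open>The two families are disjoint: their first letters \<open>p\<close> and
        \<open>a - 1\<close> differ because \<open>a \<le> p\<close>.\<close>
      unfolding Suc continuations_Suc using assms
      by (intro sum.union_disjoint) (auto intro!: finite_imageI finite_continuations)
    then show ?thesis
      by (simp add: Suc nth_monomial_mult nth_monomial_mult[where l = 1, unfolded power_one_right]
               continuation_gf_def sum_weight_Cons
               del: power_Suc)
  qed
qed

text \<open>The index \<open>i\<close> is where the descent \<open>a - 1, ..., i\<close> ends (it is
  empty for \<open>i = a\<close>); the word then stops or jumps to \<open>p\<close>.\<close>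

lemma continuation_gf_unfold:
  assumes "1 \<le> a" "a \<le> p"
  shows "continuation_gf p a = (\<Sum>i=1..a. var_x ^ (a - i) * var_y ^ (\<Sum>{i..<a}) * var_z ^ (a - i)
    * (1 + var_x * var_y ^ p * var_z ^ (1 + (p - i)) * continuation_gf p p))"
  using assms
proof (induction a rule: nat_induct_at_least)
  case base
  then show ?case by (subst continuation_gf_rec) simp_all
next
  case (Suc a)
  let ?g = "\<lambda>i. 1 + var_x * var_y ^ p * var_z ^ (1 + (p - i)) * continuation_gf p p"
  \<comment> \<open>\<open>?g (Suc a)\<close> covers the empty descent; otherwise the letter
    \<open>a\<close> is prepended to every descent starting from \<open>a\<close>.\<close>
  have "continuation_gf p (Suc a) = ?g (Suc a) + var_x * var_y ^ a * var_z * continuation_gf p a"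
    using Suc by (subst continuation_gf_rec) simp_all
  also have "var_x * var_y ^ a * var_z * continuation_gf p a =
      (\<Sum>i=1..a. var_x ^ (Suc a - i) * var_y ^ (\<Sum>{i..<Suc a}) * var_z ^ (Suc a - i) * ?g i)"
    unfolding Suc.IH[OF Suc_leD[OF Suc.prems]] sum_distrib_left
    by (intro sum.cong refl) (simp add: Suc_diff_le power_add mult_ac)
  finally show ?case by (simp add: add.commute)
qed

text \<open>The area of the descending block \<open>p, p - 1, ..., i\<close>, an arithmetic
  series.\<close>

lemma sum_interval_below:
  fixes i p :: nat
  assumes "i \<le> p"
  shows "p + \<Sum>{i..<p} = (p + i) * (p - i + 1) div 2"
proof -
  have "p + \<Sum>{i..<p} = \<Sum>{i..p}"
    using assms by (simp add: sum.last_plus)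
  also have "\<dots> = (p + i) * (p - i + 1) div 2"
  proof -
    obtain d where "p = i + d" using assms le_Suc_ex by blast
    \<comment> \<open>The left side is the numerator supplied by \<open>Sum_Icc_nat\<close>;
      substituting \<open>p = i + d\<close> removes the truncated differences.\<close>
    then have "p * (p + 1) - i * (i - 1) = (p + i) * (p - i + 1)"
      by (cases i) (simp_all add: algebra_simps)
    then show ?thesis by (simp add: Sum_Icc_nat)
  qed
  finally show ?thesis .
qed

theorem theorem1:
  fixes p :: nat
  assumes "p \<ge> 1"
  shows "fib_gf p =
    1 + (\<Sum>i=1..p. var_x ^ (p - i + 1) * var_y ^ ((p + i) * (p - i + 1) div 2) * var_z ^ (2 * p - i + 1))
      / (1 - var_x * var_y ^ p * var_z
           - (\<Sum>i=1..p - 1. var_x ^ (p - i + 1) * var_y ^ ((p + i) * (p - i + 1) div 2)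
                            * var_z ^ (2 * p - 2 * i + 1)))"
    (is "_ = 1 + ?L / ?D")
proof -
  let ?N = "\<lambda>i. var_x ^ (p - i + 1) * var_y ^ ((p + i) * (p - i + 1) div 2) * var_z ^ (2 * p - 2 * i + 1)"
  let ?T = "continuation_gf p p"
  \<comment> \<open>\<open>w\<close> is the monomial of the first column, which rises from 0 to
    \<open>p\<close>. \<open>A\<close> collects the descents from \<open>p\<close> after which the
    word stops, \<open>B\<close> those followed by a return to \<open>p\<close>.\<close>
  define w where "w = var_x * var_y ^ p * var_z ^ (1 + p)"
  define A where "A = (\<Sum>i=1..p. var_x ^ (p - i) * var_y ^ (\<Sum>{i..<p}) * var_z ^ (p - i))"
  define B where "B = (\<Sum>i=1..p. ?N i)"
  have D: "?D = 1 - B"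
  proof -
    \<comment> \<open>The summand of \<open>B\<close> for \<open>i = p\<close> is
      \<open>var_x * var_y ^ p * var_z\<close>, which the denominator lists separately.\<close>
    obtain q where "p = Suc q" using assms by (cases p) auto
    then show ?thesis by (simp add: B_def)
  qed
  have L: "w * A = ?L"
    unfolding w_def A_def sum_distrib_left
  proof (intro sum.cong refl)
    fix i assume "i \<in> {1..p}"
    then have e: "2 * p - i + 1 = 1 + p + (p - i)"
      "(p + i) * (p - i + 1) div 2 = p + \<Sum>{i..<p}"
      using sum_interval_below[of i p] by auto
    show "var_x * var_y ^ p * var_z ^ (1 + p) * (var_x ^ (p - i) * var_y ^ (\<Sum>{i..<p}) * var_z ^ (p - i))
      = var_x ^ (p - i + 1) * var_y ^ ((p + i) * (p - i + 1) div 2) * var_z ^ (2 * p - i + 1)"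
      by (simp only: e) (simp add: power_add mult_ac)
  qed
  \<comment> \<open>Distributing the unfolded formula for \<open>a = p\<close> over stopping and
    returning gives the linear equation for \<open>?T\<close>.\<close>
  have "?T = A + B * ?T"
  proof -
    have "var_x ^ (p - i) * var_y ^ (\<Sum>{i..<p}) * var_z ^ (p - i)
        * (var_x * var_y ^ p * var_z ^ (1 + (p - i))) = ?N i" if "i \<in> {1..p}" for i
    proof -
      have "2 * p - 2 * i + 1 = 1 + (p - i) + (p - i)"
        "(p + i) * (p - i + 1) div 2 = p + \<Sum>{i..<p}"
        using that sum_interval_below[of i p] by auto
      then show ?thesis
        by (simp only:) (simp add: power_add mult_ac)
    qed
    then have "B * ?T = (\<Sum>i=1..p. var_x ^ (p - i) * var_y ^ (\<Sum>{i..<p}) * var_z ^ (p - i)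
        * (var_x * var_y ^ p * var_z ^ (1 + (p - i))) * ?T)"
      unfolding B_def sum_distrib_right by (intro sum.cong refl) (simp only:)
    then show ?thesis
      using continuation_gf_unfold[of p p] assms
      unfolding A_def by (simp only: distrib_left mult_1_right sum.distrib mult.assoc le_refl)
  qed
  then have "?T * ?D = A"
    unfolding D by (simp add: algebra_simps)
  then have *: "w * ?T * ?D = ?L"
    unfolding L[symmetric] by (subst mult.assoc) (rule arg_cong)
  \<comment> \<open>Every summand of \<open>B\<close> contains a positive power of
    \<open>var_x\<close>.\<close>
  have D0: "fps_nth ?D 0 = 1"
    unfolding D by (simp add: B_def fps_sum_nth var_x_def)
  have "?L / ?D * ?D = w * ?T * ?D"
    using xyz_divide_mult_cancel[OF D0] * by simp
  moreover have "?D \<noteq> 0" using D0 by (metis fps_zero_nth zero_neq_one)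
  ultimately have "?L / ?D = w * ?T" by simp
  \<comment> \<open>At \<open>a = 0\<close> the recursion has no descending term and its rise is
    \<open>p - 0 = p\<close>.\<close>
  moreover have "fib_gf p = 1 + w * ?T"
    using continuation_gf_rec[of 0 p] assms by (simp add: fib_gf_conv_continuation_gf w_def)
  ultimately show ?thesis by simp
qed

end
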